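(* Let $\mathcal A=(A,\le_A)$, $\mathcal B=(B,\le_B)$ and $\mathcal C=(C,\le_C)$ be three finite posets (with pairwise disjoint underlying sets), and let $a,b\in A$ be distinct. Then: $$(\mathcal A\blacktriangle_a\mathcal B)\bullet_b\mathcal C=(\mathcal A\bullet_b\mathcal C)\blacktriangle_a\mathcal B,$$ $$(\mathcal A\blacktriangledown_a\mathcal B)\bullet_b\mathcal C=(\mathcal A\bullet_b\mathcal C)\blacktriangledown_a\mathcal B,$$ $$(\mathcal A\blacktriangledown_a\mathcal B)\blacktriangle_b\mathcal C=(\mathcal A\blacktriangle_b\mathcal C)\blacktriangledown_a\mathcal B.$$
   Context: For finite posets $\mathcal A=(A,\le_A)$, $\mathcal B=(B,\le_B)$ with $A\cap B=\emptyset$ and $a\in A$, each of $\mathcal A\bullet_a\mathcal B$, $\mathcal A\blacktriangle_a\mathcal B$, $\mathcal A\blacktriangledown_a\mathcal B$ is the set $(A\setminus\{a\})\sqcup B$ with a partial order $\le$ whose restriction to $B$ is $\le_B$, whose restriction to $A\setminus\{a\}$ is that of $\le_A$, and for $x\in A\setminus\{a\}$, $y\in B$: - in $\mathcal A\bullet_a\mathcal B$: $x\le y$ iff $x\le_Aa$; $y\le x$ iff $a\le_Ax$; - in $\mathcal A\blacktriangle_a\mathcal B$: $x\le y$ iff $x\le_Aa$ and $y$ is a maximal element of $\mathcal B$; $y\le x$ iff $a\le_Ax$; - in $\mathcal A\blacktriangledown_a\mathcal B$: $x\le y$ iff $x\le_Aa$; $y\le x$ iff $a\le_Ax$ and $y$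 is a minimal element of $\mathcal B$. *)

theory Defs
  imports Main
begin

text \<open>A poset is a pair of an underlying set and the graph of its order relation, where the relation
  lives on the underlying set only (this is part of \<^const>\<open>partial_order_on\<close>). Hence equality of
  pairs is equality of posets. Posets may be empty.\<close>

type_synonym 'a poset = "'a set \<times> 'a rel"

abbreviation points :: "'a poset \<Rightarrow> 'a set" where
  "points P \<equiv> fst P"

abbreviation order_rel :: "'a poset \<Rightarrow> 'a rel" where
  "order_rel P \<equiv> snd P"

definition finite_poset :: "'a poset \<Rightarrow> bool" where
  "finite_poset P \<longleftrightarrow> finite (points P) \<and> partial_order_on (points P) (order_rel P)"

definition maximal_points :: "'a poset \<Rightarrow> 'a set" where
  "maximal_points P = {y \<in> points P. \<forall>z \<in> points P. (y, z) \<in> order_rel P \<longrightarrow> z = y}"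

definition minimal_points :: "'a poset \<Rightarrow> 'a set" where
  "minimal_points P = {y \<in> points P. \<forall>z \<in> points P. (z, y) \<in> order_rel P \<longrightarrow> z = y}"

text \<open>The three insertions of \<open>B\<close> at the point \<open>a\<close> of \<open>A\<close>. They are meant for \<open>a \<in> points A\<close> and
  disjoint underlying sets; the disjoint union is then the ordinary union. The four sets forming
  each relation are the order within \<open>A\<close> without \<open>a\<close>, the order within \<open>B\<close>, and the relations
  from \<open>A\<close> to \<open>B\<close> and from \<open>B\<close> to \<open>A\<close>.\<close>

definition insert_full :: "'a poset \<Rightarrow> 'a \<Rightarrow> 'a poset \<Rightarrow> 'a poset"
    (\<open>(_ \<bullet>\<^bsub>_\<^esub> _)\<close> [66, 0, 66] 65) where
  "A \<bullet>\<^bsub>a\<^esub> B =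
    ((points A - {a}) \<union> points B,
     {(x, x'). x \<in> points A - {a} \<and> x' \<in> points A - {a} \<and> (x, x') \<in> order_rel A} \<union>
     {(y, y'). y \<in> points B \<and> y' \<in> points B \<and> (y, y') \<in> order_rel B} \<union>
     {(x, y). x \<in> points A - {a} \<and> y \<in> points B \<and> (x, a) \<in> order_rel A} \<union>
     {(y, x). x \<in> points A - {a} \<and> y \<in> points B \<and> (a, x) \<in> order_rel A})"

definition insert_up :: "'a poset \<Rightarrow> 'a \<Rightarrow> 'a poset \<Rightarrow> 'a poset"
    (\<open>(_ \<triangle>\<^bsub>_\<^esub> _)\<close> [66, 0, 66] 65) where
  "A \<triangle>\<^bsub>a\<^esub> B =
    ((points A - {a}) \<union> points B,
     {(x, x'). x \<in> points A - {a} \<and> x' \<in> points A - {a} \<and> (x, x') \<in> order_rel A} \<union>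
     {(y, y'). y \<in> points B \<and> y' \<in> points B \<and> (y, y') \<in> order_rel B} \<union>
     {(x, y). x \<in> points A - {a} \<and> y \<in> maximal_points B \<and> (x, a) \<in> order_rel A} \<union>
     {(y, x). x \<in> points A - {a} \<and> y \<in> points B \<and> (a, x) \<in> order_rel A})"

definition insert_down :: "'a poset \<Rightarrow> 'a \<Rightarrow> 'a poset \<Rightarrow> 'a poset"
    (\<open>(_ \<nabla>\<^bsub>_\<^esub> _)\<close> [66, 0, 66] 65) where
  "A \<nabla>\<^bsub>a\<^esub> B =
    ((points A - {a}) \<union> points B,
     {(x, x'). x \<in> points A - {a} \<and> x' \<in> points A - {a} \<and> (x, x') \<in> order_rel A} \<union>
     {(y, y'). y \<in> points B \<and> y' \<in> points B \<and> (y, y') \<in> order_rel B} \<union>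
     {(x, y). x \<in> points A - {a} \<and> y \<in> points B \<and> (x, a) \<in> order_rel A} \<union>
     {(y, x). x \<in> points A - {a} \<and> y \<in> minimal_points B \<and> (a, x) \<in> order_rel A})"

text \<open>The operations produce finite posets.\<close>

lemma finite_posetI:
  assumes "finite (points P)" "order_rel P \<subseteq> points P \<times> points P"
    and "\<And>x. x \<in> points P \<Longrightarrow> (x, x) \<in> order_rel P"
    and "\<And>x y z. (x, y) \<in> order_rel P \<Longrightarrow> (y, z) \<in> order_rel P \<Longrightarrow> (x, z) \<in> order_rel P"
    and "\<And>x y. (x, y) \<in> order_rel P \<Longrightarrow> (y, x) \<in> order_rel P \<Longrightarrow> x = y"
  shows "finite_poset P"
  using assms unfolding finite_poset_def order_on_defs refl_on_def trans_def antisym_def by blast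

lemma finite_posetD:
  assumes "finite_poset P"
  shows "finite (points P)" "order_rel P \<subseteq> points P \<times> points P"
    and "\<And>x. x \<in> points P \<Longrightarrow> (x, x) \<in> order_rel P"
    and "\<And>x y z. (x, y) \<in> order_rel P \<Longrightarrow> (y, z) \<in> order_rel P \<Longrightarrow> (x, z) \<in> order_rel P"
    and "\<And>x y. (x, y) \<in> order_rel P \<Longrightarrow> (y, x) \<in> order_rel P \<Longrightarrow> x = y"
  using assms unfolding finite_poset_def order_on_defs refl_on_def trans_def antisym_def by blast+

lemma finite_poset_insert_full:
  assumes A: "finite_poset A" and B: "finite_poset B" and disj: "points A \<inter> points B = {}"
  shows "finite_poset (A \<bullet>\<^bsub>a\<^esub> B)"
proof -
  note A = finite_posetD[OF A] and B = finite_posetD[OF B]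
  have sepA: "x \<notin> points B" if "x \<in> points A" for x using disj that by blast
  have sepB: "x \<notin> points A" if "x \<in> points B" for x using disj that by blast
  show ?thesis
  proof (rule finite_posetI)
    fix x y z
    assume "(x, y) \<in> order_rel (A \<bullet>\<^bsub>a\<^esub> B)" "(y, z) \<in> order_rel (A \<bullet>\<^bsub>a\<^esub> B)"
    then show "(x, z) \<in> order_rel (A \<bullet>\<^bsub>a\<^esub> B)"
      by (auto simp: insert_full_def dest: A(4,5) B(4,5) sepA sepB)
  next
    fix x y
    assume "(x, y) \<in> order_rel (A \<bullet>\<^bsub>a\<^esub> B)" "(y, x) \<in> order_rel (A \<bullet>\<^bsub>a\<^esub> B)"
    then show "x = y"
      by (auto simp: insert_full_def dest: A(5) B(5) sepA sepB)
  qed (use A(1,3) B(1,3) in \<open>auto simp: insert_full_def\<close>)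
qed

lemma finite_poset_insert_up:
  assumes A: "finite_poset A" and B: "finite_poset B" and disj: "points A \<inter> points B = {}"
  shows "finite_poset (A \<triangle>\<^bsub>a\<^esub> B)"
proof -
  note A = finite_posetD[OF A] and B = finite_posetD[OF B]
  have sepA: "x \<notin> points B" if "x \<in> points A" for x using disj that by blast
  have sepB: "x \<notin> points A" if "x \<in> points B" for x using disj that by blast
  show ?thesis
  proof (rule finite_posetI)
    fix x y z
    assume "(x, y) \<in> order_rel (A \<triangle>\<^bsub>a\<^esub> B)" "(y, z) \<in> order_rel (A \<triangle>\<^bsub>a\<^esub> B)"
    then show "(x, z) \<in> order_rel (A \<triangle>\<^bsub>a\<^esub> B)"
      by (auto simp: insert_up_def maximal_points_def dest: A(4,5) B(4,5) sepA sepB)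
  next
    fix x y
    assume "(x, y) \<in> order_rel (A \<triangle>\<^bsub>a\<^esub> B)" "(y, x) \<in> order_rel (A \<triangle>\<^bsub>a\<^esub> B)"
    then show "x = y"
      by (auto simp: insert_up_def maximal_points_def dest: A(5) B(5) sepA sepB)
  qed (use A(1,3) B(1,3) in \<open>auto simp: insert_up_def maximal_points_def\<close>)
qed

lemma finite_poset_insert_down:
  assumes A: "finite_poset A" and B: "finite_poset B" and disj: "points A \<inter> points B = {}"
  shows "finite_poset (A \<nabla>\<^bsub>a\<^esub> B)"
proof -
  note A = finite_posetD[OF A] and B = finite_posetD[OF B]
  have sepA: "x \<notin> points B" if "x \<in> points A" for x using disj that by blast
  have sepB: "x \<notin> points A" if "x \<in> points B" for x using disj that by blast
  show ?thesis
  proof (rule finite_posetI)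
    fix x y z
    assume "(x, y) \<in> order_rel (A \<nabla>\<^bsub>a\<^esub> B)" "(y, z) \<in> order_rel (A \<nabla>\<^bsub>a\<^esub> B)"
    then show "(x, z) \<in> order_rel (A \<nabla>\<^bsub>a\<^esub> B)"
      by (auto simp: insert_down_def minimal_points_def dest: A(4,5) B(4,5) sepA sepB)
  next
    fix x y
    assume "(x, y) \<in> order_rel (A \<nabla>\<^bsub>a\<^esub> B)" "(y, x) \<in> order_rel (A \<nabla>\<^bsub>a\<^esub> B)"
    then show "x = y"
      by (auto simp: insert_down_def minimal_points_def dest: A(5) B(5) sepA sepB)
  qed (use A(1,3) B(1,3) in \<open>auto simp: insert_down_def minimal_points_def\<close>)
qed

end

theory Submission
  imports Defs
begin

text \<open>All three insertions are instances of one operation, in which two sets \<open>U\<close> and \<open>D\<close> of points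
  of \<open>B\<close> say which points lie above the predecessors of \<open>a\<close> and below its successors. Insertions
  of this kind at distinct points commute, since \<open>B\<close> and \<open>C\<close> are related only through \<open>a\<close> and \<open>b\<close>:
  \<open>y \<in> B\<close> lies below \<open>z \<in> C\<close> iff \<open>a \<le> b\<close>, \<open>y\<close> is in the lower set of \<open>B\<close> and \<open>z\<close> in the upper set
  of \<open>C\<close>, in either order of insertion.\<close>

definition insert_between :: "'a set \<Rightarrow> 'a set \<Rightarrow> 'a poset \<Rightarrow> 'a \<Rightarrow> 'a poset \<Rightarrow> 'a poset" where
  "insert_between U D A a B =
    ((points A - {a}) \<union> points B,
     {(x, x'). x \<in> points A - {a} \<and> x' \<in> points A - {a} \<and> (x, x') \<in> order_rel A} \<union>
     {(y, y'). y \<in> points B \<and> y' \<in> points B \<and> (y, y') \<in> order_rel B} \<union>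
     {(x, y). x \<in> points A - {a} \<and> y \<in> U \<and> (x, a) \<in> order_rel A} \<union>
     {(y, x). x \<in> points A - {a} \<and> y \<in> D \<and> (a, x) \<in> order_rel A})"

lemma insert_full_eq_between: "A \<bullet>\<^bsub>a\<^esub> B = insert_between (points B) (points B) A a B"
  by (simp add: insert_full_def insert_between_def)

lemma insert_up_eq_between: "A \<triangle>\<^bsub>a\<^esub> B = insert_between (maximal_points B) (points B) A a B"
  by (simp add: insert_up_def insert_between_def)

lemma insert_down_eq_between: "A \<nabla>\<^bsub>a\<^esub> B = insert_between (points B) (minimal_points B) A a B"
  by (simp add: insert_down_def insert_between_def)

lemma points_insert_between: "points (insert_between U D A a B) = (points A - {a}) \<union> points B"
  by (simp add: insert_between_def)

lemma order_rel_insert_between_iff: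
  "(p, q) \<in> order_rel (insert_between U D A a B) \<longleftrightarrow>
     p \<in> points A - {a} \<and> q \<in> points A - {a} \<and> (p, q) \<in> order_rel A \<or>
     p \<in> points B \<and> q \<in> points B \<and> (p, q) \<in> order_rel B \<or>
     p \<in> points A - {a} \<and> q \<in> U \<and> (p, a) \<in> order_rel A \<or>
     q \<in> points A - {a} \<and> p \<in> D \<and> (a, q) \<in> order_rel A"
  by (auto simp: insert_between_def)

text \<open>As \<open>a\<close> and \<open>b\<close> are distinct, \<open>b\<close> survives the
  insertion at \<open>a\<close>. Its predecessors are then the old ones other than \<open>a\<close>,
  together with \<open>D\<close> if a \<le> b; dually, its successors gain \<open>U\<close> if b
  \<le> a. Inserting \<open>C\<close> first changes the neighbours of \<open>a\<close> in the same
  way, so both orders create the same cross relations.\<close>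

lemma insert_between_commute:
  assumes "points A \<inter> points B = {}" "points A \<inter> points C = {}" "points B \<inter> points C = {}"
    and "a \<in> points A" "b \<in> points A" "a \<noteq> b"
    and "U \<subseteq> points B" "D \<subseteq> points B" "V \<subseteq> points C" "E \<subseteq> points C"
  shows "insert_between V E (insert_between U D A a B) b C =
    insert_between U D (insert_between V E A b C) a B"
proof (rule prod_eqI)
  \<comment> \<open>Hence the second deletion takes nothing away from the poset inserted
    first.\<close>
  have a: "a \<notin> points B" "a \<notin> points C" and b: "b \<notin> points B" "b \<notin> points C"
    using assms by blast+
  then show "points (insert_between V E (insert_between U D A a B) b C) =
      points (insert_between U D (insert_between V E A b C) a B)"
    unfolding points_insert_between by blast
  have "(p, q) \<in> order_rel (insert_between V E (insert_between U D A a B) b C) \<longleftrightarrow>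
      (p, q) \<in> order_rel (insert_between U D (insert_between V E A b C) a B)" for p q
  proof -
    have B: "p \<notin> points A \<and> p \<notin> points C \<and> p \<notin> V \<and> p \<notin> E \<and> p \<noteq> a \<and> p \<noteq> b"
      if "p \<in> points B" for p
      using that assms by blast
    have C: "p \<notin> points A \<and> p \<notin> points B \<and> p \<notin> U \<and> p \<notin> D \<and> p \<noteq> a \<and> p \<noteq> b"
      if "p \<in> points C" for p
      using that assms by blast
    have outside: "p \<notin> U \<and> p \<notin> D" if "p \<notin> points B" for p
      using that assms by blast
    have outside': "p \<notin> V \<and> p \<notin> E" if "p \<notin> points C" for p
      using that assms by blast
    \<comment> \<open>Nine cases by location. The third alternative covers \<open>A\<close> as well
      as points outside all three posets, since \<open>p\<close> and \<open>q\<close> are arbitrary.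
      In each case the separation facts above settle most memberships.\<close>
    have "p \<in> points B \<or> p \<in> points C \<or> p \<notin> points B \<and> p \<notin> points C"
      and "q \<in> points B \<or> q \<in> points C \<or> q \<notin> points B \<and> q \<notin> points C"
      by blast+
    then show ?thesis
      unfolding order_rel_insert_between_iff points_insert_between
      by (elim disjE conjE; simp add: a b B C outside outside' assms(4-6) assms(6)[symmetric]; blast?)
  qed
  then show "order_rel (insert_between V E (insert_between U D A a B) b C) =
      order_rel (insert_between U D (insert_between V E A b C) a B)"
    by auto
qed

theorem proposition11:
  fixes A B C :: "'a poset" and a b :: 'a
  assumes "finite_poset A" and "finite_poset B" and "finite_poset C"
    and "points A \<inter> points B = {}" and "points A \<inter> points C = {}" and "points B \<inter> points C = {}"
    and "a \<in> points A" and "b \<in> points A" and "a \<noteq> b"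
  shows "(A \<triangle>\<^bsub>a\<^esub> B) \<bullet>\<^bsub>b\<^esub> C = (A \<bullet>\<^bsub>b\<^esub> C) \<triangle>\<^bsub>a\<^esub> B
    \<and> (A \<nabla>\<^bsub>a\<^esub> B) \<bullet>\<^bsub>b\<^esub> C = (A \<bullet>\<^bsub>b\<^esub> C) \<nabla>\<^bsub>a\<^esub> B
    \<and> (A \<nabla>\<^bsub>a\<^esub> B) \<triangle>\<^bsub>b\<^esub> C = (A \<triangle>\<^bsub>b\<^esub> C) \<nabla>\<^bsub>a\<^esub> B"
proof -
  have "maximal_points P \<subseteq> points P" "minimal_points P \<subseteq> points P" for P :: "'a poset"
    by (auto simp: maximal_points_def minimal_points_def)
  then show ?thesis
    \<comment> \<open>In the third equation, for example, \<open>D\<close> consists of the minimal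
      points of \<open>B\<close> and \<open>V\<close> of the maximal points of \<open>C\<close>,
      while \<open>U\<close> and \<open>E\<close> are full; \<open>order_refl\<close> handles the
      inclusions of full sets.\<close>
    unfolding insert_full_eq_between insert_up_eq_between insert_down_eq_between
    by (intro conjI insert_between_commute assms order_refl)
qed

end
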